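(* Let $\mathfrak A$ be a complex topological vector space and let $\tau:\mathfrak A\times\mathfrak A\times\mathfrak A\to\mathfrak A$ be a continuous trilinear map. Then the ternary algebra $(\mathfrak A,\tau)$ is lr-partially associative if and only if $\mathfrak E_2$ is an associative vector bundle of binary algebras over $(\mathfrak A,\tau)$. In particular, if $(\mathfrak A,\tau)$ is lr-partially associative, then each fiber of the vector bundle $\mathfrak E_2$ is an associative binary algebra, and the binary algebra $\Gamma(\mathfrak E_2)$ of continuous sections of this bundle is an associative algebra.
   Context: A ternary algebra $(\mathfrak A,\tau)$ is a complex vector space $\mathfrak A$ with a trilinear map $\tau:\mathfrak A\times\mathfrak A\times\mathfrak A\to\mathfrak A$. It is lr-partially associative if $\tau(\tau(a,b,c),d,f)=\tau(a,b,\tau(c,d,f))$ for all $a,b,c,d,f\in\mathfrak A$. A binary algebra is a vector space with a bilinear multiplication (not assumed associative). For $a\in\mathfrak A$ define the bilinear multiplication $\tau^2_a(b,c)=\tau(b,a,c)$ on $\mathfrak A$. Let $\mathfrak E=\mathfrak A\times\mathfrak A$ be the trivial vector bundle over the base $\mathfrak A$ with projection $\pi(a,b)=a$. For $a\in\mathfrak A$ let $\phi_a:\pi^{-1}(a)\to\mathfrak A$, $\phi_a(a,b)=b$, and for $a,b\in\mathfrak A$ let $\phi^a_b=\phi_b^{-1}\circ\phi_a:\pi^{-1}(a)\to\pi^{-1}(b)$. The bundle $\mathfrak E_2$ is $\mathfrak E$ with each fiber $\pi^{-1}(a)$ equipped with the binary multiplication, again denoted $\tau^2_a$, determined by $\phi_a(\tau^2_a(p,q))=\tau^2_a(\phi_a(p),\phi_a(q))$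 for $p,q\in\pi^{-1}(a)$. $\mathfrak E_2$ is called an associative vector bundle of binary algebras over $(\mathfrak A,\tau)$ if for all $p,q\in\mathfrak E_2$ and all $a\in\mathfrak A$ $$\phi_{\pi(q)}\Big(\tau^2_{\pi(q)}\big(\phi^{\pi(p)}_{\pi(q)}(\tau^2_{\pi(p)}(p,\phi^{-1}_{\pi(p)}(a))),\,q\big)\Big)=\phi_{\pi(p)}\Big(\tau^2_{\pi(p)}\big(p,\,\phi^{\pi(q)}_{\pi(p)}(\tau^2_{\pi(q)}(\phi^{-1}_{\pi(q)}(a),q))\big)\Big).$$ $\Gamma(\mathfrak E_2)$ is the vector space of continuous maps $\xi:\mathfrak A\to\mathfrak E_2$ with $\pi\circ\xi=\mathrm{id}_{\mathfrak A}$, equipped with the multiplication $(\xi,\eta)\mapsto\tau^2(\xi,\eta)$, $\tau^2(\xi,\eta)(a)=\tau^2_a(\xi(a),\eta(a))$. *)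

theory Defs
  imports Complex_Main "HOL-Algebra.Module" "HOL-Algebra.Algebraic_Closure_Type"
begin

text \<open>Topological vector spaces are not assumed to be Hausdorff.\<close>

locale complex_topological_vector_space = vector_space scale
  for scale :: "complex \<Rightarrow> 'a::topological_ab_group_add \<Rightarrow> 'a" +
  assumes continuous_scale: "continuous_on UNIV (\<lambda>(c, x). scale c x)"

locale ternary_algebra = vector_space scale
  for scale :: "complex \<Rightarrow> 'a::ab_group_add \<Rightarrow> 'a" +
  fixes \<tau> :: "'a \<Rightarrow> 'a \<Rightarrow> 'a \<Rightarrow> 'a"
  assumes linear_left: "Vector_Spaces.linear scale scale (\<lambda>x. \<tau> x b c)"
    and linear_middle: "Vector_Spaces.linear scale scale (\<lambda>x. \<tau> a x c)"
    and linear_right: "Vector_Spaces.linear scale scale (\<lambda>x. \<tau> a b x)"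

definition lr_partially_associative :: "('a \<Rightarrow> 'a \<Rightarrow> 'a \<Rightarrow> 'a) \<Rightarrow> bool" where
  "lr_partially_associative \<tau> \<longleftrightarrow> (\<forall>a b c d f. \<tau> (\<tau> a b c) d f = \<tau> a b (\<tau> c d f))"

text \<open>
  A complex binary algebra is a module over the field \<open>\<complex>\<close> with a bilinear multiplication,
  in general neither associative nor unital: the record component \<open>one\<close> plays no role.
\<close>

locale binary_algebra = Module.module "ring_of_type_algebra :: complex ring" M
  for M :: "(complex, 'b, 'm) module_scheme" (structure) +
  assumes mult_closed: "\<lbrakk>x \<in> carrier M; y \<in> carrier M\<rbrakk> \<Longrightarrow> x \<otimes> y \<in> carrier M"
    and mult_add_left: "\<lbrakk>x \<in> carrier M; y \<in> carrier M; z \<in> carrier M\<rbrakk>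
      \<Longrightarrow> (x \<oplus> y) \<otimes> z = (x \<otimes> z) \<oplus> (y \<otimes> z)"
    and mult_add_right: "\<lbrakk>x \<in> carrier M; y \<in> carrier M; z \<in> carrier M\<rbrakk>
      \<Longrightarrow> x \<otimes> (y \<oplus> z) = (x \<otimes> y) \<oplus> (x \<otimes> z)"
    and mult_smult_left: "\<lbrakk>x \<in> carrier M; y \<in> carrier M\<rbrakk>
      \<Longrightarrow> (c \<odot> x) \<otimes> y = c \<odot> (x \<otimes> y)"
    and mult_smult_right: "\<lbrakk>x \<in> carrier M; y \<in> carrier M\<rbrakk>
      \<Longrightarrow> x \<otimes> (c \<odot> y) = c \<odot> (x \<otimes> y)"

locale associative_binary_algebra = binary_algebra +
  assumes mult_assoc: "\<lbrakk>x \<in> carrier M; y \<in> carrier M; z \<in> carrier M\<rbrakk>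
      \<Longrightarrow> (x \<otimes> y) \<otimes> z = x \<otimes> (y \<otimes> z)"

definition tau2 :: "('a \<Rightarrow> 'a \<Rightarrow> 'a \<Rightarrow> 'a) \<Rightarrow> 'a \<Rightarrow> 'a \<Rightarrow> 'a \<Rightarrow> 'a" where
  "tau2 \<tau> a b c = \<tau> b a c"

text \<open>
  The total space of the trivial bundle is the whole product type \<open>'a \<times> 'a\<close> (with the product
  topology), the base is \<open>'a\<close>.
\<close>

definition bundle_proj :: "'a \<times> 'a \<Rightarrow> 'a" where
  "bundle_proj = fst"

definition fiber :: "'a \<Rightarrow> ('a \<times> 'a) set" where
  "fiber a = bundle_proj -` {a}"

definition fiber_chart :: "'a \<Rightarrow> 'a \<times> 'a \<Rightarrow> 'a" where
  "fiber_chart a = (\<lambda>p\<in>fiber a. snd p)"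

abbreviation fiber_chart_inv :: "'a \<Rightarrow> 'a \<Rightarrow> 'a \<times> 'a" where
  "fiber_chart_inv a \<equiv> inv_into (fiber a) (fiber_chart a)"

text \<open>\<open>fiber_transition a b\<close> maps the fiber over \<open>a\<close> to the fiber over \<open>b\<close>.\<close>

definition fiber_transition :: "'a \<Rightarrow> 'a \<Rightarrow> 'a \<times> 'a \<Rightarrow> 'a \<times> 'a" where
  "fiber_transition a b = fiber_chart_inv b \<circ> fiber_chart a"

definition fiber_mult ::
  "('a \<Rightarrow> 'a \<Rightarrow> 'a \<Rightarrow> 'a) \<Rightarrow> 'a \<Rightarrow> 'a \<times> 'a \<Rightarrow> 'a \<times> 'a \<Rightarrow> 'a \<times> 'a" where
  "fiber_mult \<tau> a p q = fiber_chart_inv a (tau2 \<tau> a (fiber_chart a p) (fiber_chart a q))"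

definition associative_vector_bundle :: "('a \<Rightarrow> 'a \<Rightarrow> 'a \<Rightarrow> 'a) \<Rightarrow> bool" where
  "associative_vector_bundle \<tau> \<longleftrightarrow> (\<forall>p q a.
     fiber_chart (bundle_proj q)
       (fiber_mult \<tau> (bundle_proj q)
         (fiber_transition (bundle_proj p) (bundle_proj q)
           (fiber_mult \<tau> (bundle_proj p) p (fiber_chart_inv (bundle_proj p) a)))
         q) =
     fiber_chart (bundle_proj p)
       (fiber_mult \<tau> (bundle_proj p)
         p
         (fiber_transition (bundle_proj q) (bundle_proj p)
           (fiber_mult \<tau> (bundle_proj q) (fiber_chart_inv (bundle_proj q) a) q))))"

text \<open>The linear structure of a fiber is the one that makes its chart a linear isomorphism.\<close>

definition fiber_algebra ::
  "(complex \<Rightarrow> 'a::ab_group_add \<Rightarrow> 'a) \<Rightarrow> ('a \<Rightarrow> 'a \<Rightarrow> 'a \<Rightarrow> 'a) \<Rightarrow> 'a \<Rightarrow> (complex, 'a \<times> 'a) module"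
  where
  "fiber_algebra scale \<tau> a =
     \<lparr>carrier = fiber a,
      monoid.mult = fiber_mult \<tau> a,
      one = undefined,
      zero = fiber_chart_inv a 0,
      add = \<lambda>p q. fiber_chart_inv a (fiber_chart a p + fiber_chart a q),
      module.smult = \<lambda>c p. fiber_chart_inv a (scale c (fiber_chart a p))\<rparr>"

definition continuous_sections :: "('a::topological_space \<Rightarrow> 'a \<times> 'a) set" where
  "continuous_sections = {\<xi>. continuous_on UNIV \<xi> \<and> bundle_proj \<circ> \<xi> = id}"

definition section_algebra ::
  "(complex \<Rightarrow> 'a::topological_ab_group_add \<Rightarrow> 'a) \<Rightarrow> ('a \<Rightarrow> 'a \<Rightarrow> 'a \<Rightarrow> 'a)
    \<Rightarrow> (complex, 'a \<Rightarrow> 'a \<times> 'a) module"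
  where
  "section_algebra scale \<tau> =
     \<lparr>carrier = continuous_sections,
      monoid.mult = \<lambda>\<xi> \<eta> a. \<xi> a \<otimes>\<^bsub>fiber_algebra scale \<tau> a\<^esub> \<eta> a,
      one = undefined,
      zero = \<lambda>a. \<zero>\<^bsub>fiber_algebra scale \<tau> a\<^esub>,
      add = \<lambda>\<xi> \<eta> a. \<xi> a \<oplus>\<^bsub>fiber_algebra scale \<tau> a\<^esub> \<eta> a,
      module.smult = \<lambda>c \<xi> a. c \<odot>\<^bsub>fiber_algebra scale \<tau> a\<^esub> \<xi> a\<rparr>"

end

theory Submission
  imports Defs
begin

text \<open>The trivial charts reduce everything to second components. For p = (b, x) and q = (d,
  y), the bundle condition at a becomes \<tau>(\<tau>(x, b, a), d, y) = \<tau>(x, b, \<tau>(a, d,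
  y)). As p, q and a vary, the five letters range freely, so this is exactly lr-partial
  associativity (\<open>associative_vector_bundle_iff\<close>). The case b = d is associativity of a
  fiber, and sections multiply pointwise, so they inherit it. What remains is that fibers and
  sections form binary algebras (\<open>binary_algebra_fiber\<close>,
  \<open>binary_algebra_sections\<close>); for sections the point is that the operations preserve
  continuity.\<close>

lemma mem_fiber_iff: "p \<in> fiber a \<longleftrightarrow> fst p = a"
  by (simp add: fiber_def bundle_proj_def)

text \<open>Off the fiber the chart returns \<open>undefined\<close>; hence the condition on
  \<open>fst p\<close>, which recurs in the later rules that evaluate a chart.\<close>

lemma fiber_chart_eq: "fst p = a \<Longrightarrow> fiber_chart a p = snd p"
  by (simp add: fiber_chart_def mem_fiber_iff)

text \<open>The chart is a bijection from the fiber onto the whole type, so the choice hidden in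
  \<open>inv_into\<close> is forced.\<close>

lemma fiber_chart_inv_eq: "fiber_chart_inv a x = (a, x)"
proof (rule inv_into_f_eq)
  show "inj_on (fiber_chart a) (fiber a)"
    by (auto simp: inj_on_def fiber_chart_eq mem_fiber_iff intro: prod_eqI)
qed (auto simp: fiber_chart_eq mem_fiber_iff)

lemma fiber_mult_eq:
  "\<lbrakk>fst p = a; fst q = a\<rbrakk> \<Longrightarrow> fiber_mult \<tau> a p q = (a, \<tau> (snd p) a (snd q))"
  by (simp add: fiber_mult_def fiber_chart_inv_eq fiber_chart_eq tau2_def)

lemma fiber_transition_eq: "fst p = a \<Longrightarrow> fiber_transition a b p = (b, snd p)"
  by (simp add: fiber_transition_def fiber_chart_inv_eq fiber_chart_eq)

lemma associative_vector_bundle_iff: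
  "associative_vector_bundle \<tau> \<longleftrightarrow> lr_partially_associative \<tau>"
  unfolding associative_vector_bundle_def lr_partially_associative_def
  by (auto simp: bundle_proj_def fiber_chart_inv_eq fiber_chart_eq fiber_mult_eq
      fiber_transition_eq)

text \<open>A section is the graph map of its second component, so continuity of sections reduces to
  continuity of maps from the base to itself.\<close>

lemma mem_continuous_sections_iff:
  "\<xi> \<in> continuous_sections \<longleftrightarrow> continuous_on UNIV (\<lambda>a. snd (\<xi> a)) \<and> (\<forall>a. fst (\<xi> a) = a)"
proof -
  have "continuous_on UNIV \<xi>"
    if "continuous_on UNIV (\<lambda>a. snd (\<xi> a))" "\<And>a. fst (\<xi> a) = a"
  proof -
    have "\<xi> = (\<lambda>a. (a, snd (\<xi> a)))"
      using that(2) by (metis prod.collapse)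
    moreover have "continuous_on UNIV (\<lambda>a. (a, snd (\<xi> a)))"
      by (rule continuous_on_Pair[OF continuous_on_id that(1)])
    ultimately show ?thesis by metis
  qed
  then show ?thesis
    by (auto simp: continuous_sections_def bundle_proj_def fun_eq_iff intro: continuous_on_snd)
qed

lemma fst_section: "\<xi> \<in> continuous_sections \<Longrightarrow> fst (\<xi> a) = a"
  by (simp add: mem_continuous_sections_iff)

lemma fiber_algebra_sel:
  "carrier (fiber_algebra scale \<tau> a) = fiber a"
  "\<zero>\<^bsub>fiber_algebra scale \<tau> a\<^esub> = (a, 0)"
  "\<lbrakk>fst p = a; fst q = a\<rbrakk> \<Longrightarrow> p \<oplus>\<^bsub>fiber_algebra scale \<tau> a\<^esub> q = (a, snd p + snd q)"
  "\<lbrakk>fst p = a; fst q = a\<rbrakk> \<Longrightarrow> p \<otimes>\<^bsub>fiber_algebra scale \<tau> a\<^esub> q = (a, \<tau> (snd p) a (snd q))"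
  "fst p = a \<Longrightarrow> r \<odot>\<^bsub>fiber_algebra scale \<tau> a\<^esub> p = (a, scale r (snd p))"
  by (simp_all add: fiber_algebra_def fiber_chart_inv_eq fiber_chart_eq fiber_mult_eq)

lemma section_algebra_sel:
  "carrier (section_algebra scale \<tau>) = continuous_sections"
  "\<zero>\<^bsub>section_algebra scale \<tau>\<^esub> = (\<lambda>a. \<zero>\<^bsub>fiber_algebra scale \<tau> a\<^esub>)"
  "\<xi> \<oplus>\<^bsub>section_algebra scale \<tau>\<^esub> \<eta> = (\<lambda>a. \<xi> a \<oplus>\<^bsub>fiber_algebra scale \<tau> a\<^esub> \<eta> a)"
  "\<xi> \<otimes>\<^bsub>section_algebra scale \<tau>\<^esub> \<eta> = (\<lambda>a. \<xi> a \<otimes>\<^bsub>fiber_algebra scale \<tau> a\<^esub> \<eta> a)"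
  "r \<odot>\<^bsub>section_algebra scale \<tau>\<^esub> \<xi> = (\<lambda>a. r \<odot>\<^bsub>fiber_algebra scale \<tau> a\<^esub> \<xi> a)"
  by (simp_all add: section_algebra_def)

context ternary_algebra
begin

text \<open>The outer slots carry the two factors of the fiber product and the middle slot the base
  point, so linearity in the outer slots yields bilinearity on each fiber.\<close>

lemma tau_add:
  "\<tau> (x + y) b c = \<tau> x b c + \<tau> y b c"
  "\<tau> a b (x + y) = \<tau> a b x + \<tau> a b y"
  using linear_left[of b c] linear_right[of a b]
  by (simp_all add: Vector_Spaces.linear_def module_hom_def module_hom_axioms_def)

lemma tau_scale:
  "\<tau> (scale r x) b c = scale r (\<tau> x b c)"
  "\<tau> a b (scale r x) = scale r (\<tau> a b x)"
  using linear_left[of b c] linear_right[of a b]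
  by (simp_all add: Vector_Spaces.linear_def module_hom_def module_hom_axioms_def)

lemma binary_algebra_fiber: "binary_algebra (fiber_algebra scale \<tau> a)"
proof (intro binary_algebra.intro binary_algebra_axioms.intro moduleI abelian_groupI)
  show "cring (ring_of_type_algebra :: complex ring)"
    by (rule cring_from_type_algebra)
next
  \<comment> \<open>Existence of an additive inverse needs a witness: negate the fiber coordinate.
    The remaining axioms are closure conditions and identities in the second component.\<close>
  fix p
  assume "p \<in> carrier (fiber_algebra scale \<tau> a)"
  then show "\<exists>q\<in>carrier (fiber_algebra scale \<tau> a).
      q \<oplus>\<^bsub>fiber_algebra scale \<tau> a\<^esub> p = \<zero>\<^bsub>fiber_algebra scale \<tau> a\<^esub>"
    by (intro bexI[of _ "(a, - snd p)"]) (simp_all add: fiber_algebra_sel mem_fiber_iff)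
qed (auto simp: fiber_algebra_sel mem_fiber_iff tau_add tau_scale scale_right_distrib
    scale_left_distrib ring_of_type_algebra_def add_ac intro: prod_eqI)

end

lemma binary_algebra_sections:
  fixes scale :: "complex \<Rightarrow> 'a::topological_ab_group_add \<Rightarrow> 'a"
  assumes tvs: "complex_topological_vector_space scale"
    and alg: "ternary_algebra scale \<tau>"
    and cont: "continuous_on UNIV (\<lambda>(a, b, c). \<tau> a b c)"
  shows "binary_algebra (section_algebra scale \<tau>)"
proof -
  interpret complex_topological_vector_space scale by fact
  interpret ternary_algebra scale \<tau> by fact
  have cont_scale: "continuous_on UNIV (\<lambda>a. scale r (f a))"
    if "continuous_on UNIV f" for r and f :: "'a \<Rightarrow> 'a"
    using continuous_on_compose2[OF continuous_scale, of UNIV "\<lambda>a. (r, f a)"] that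
    by (simp add: continuous_on_Pair)
  \<comment> \<open>In a product of sections the base point in the middle slot varies too; joint
    continuity of \<tau> is therefore composed with a \<mapsto> (f a, a, g a).\<close>
  have cont_tau: "continuous_on UNIV (\<lambda>a. \<tau> (f a) a (g a))"
    if "continuous_on UNIV f" "continuous_on UNIV g" for f g :: "'a \<Rightarrow> 'a"
    using continuous_on_compose2[OF cont, of UNIV "\<lambda>a. (f a, a, g a)"] that
    by (simp add: continuous_on_Pair)
  note sel = section_algebra_sel fiber_algebra_sel fst_section
  \<comment> \<open>The last item supplies the additive inverse of a section.\<close>
  have closed:
    "\<zero>\<^bsub>section_algebra scale \<tau>\<^esub> \<in> continuous_sections"
    "\<lbrakk>\<xi> \<in> continuous_sections; \<eta> \<in> continuous_sections\<rbrakk>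
      \<Longrightarrow> \<xi> \<oplus>\<^bsub>section_algebra scale \<tau>\<^esub> \<eta> \<in> continuous_sections"
    "\<lbrakk>\<xi> \<in> continuous_sections; \<eta> \<in> continuous_sections\<rbrakk>
      \<Longrightarrow> \<xi> \<otimes>\<^bsub>section_algebra scale \<tau>\<^esub> \<eta> \<in> continuous_sections"
    "\<xi> \<in> continuous_sections \<Longrightarrow> r \<odot>\<^bsub>section_algebra scale \<tau>\<^esub> \<xi> \<in> continuous_sections"
    "\<xi> \<in> continuous_sections \<Longrightarrow> (\<lambda>a. (a, - snd (\<xi> a))) \<in> continuous_sections"
    for \<xi> \<eta> r
    by (simp_all add: sel mem_continuous_sections_iff cont_scale cont_tau
        continuous_on_add continuous_on_minus)
  show ?thesis
  proof (intro binary_algebra.intro binary_algebra_axioms.intro moduleI abelian_groupI)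
    show "cring (ring_of_type_algebra :: complex ring)"
      by (rule cring_from_type_algebra)
  next
    fix \<xi>
    assume "\<xi> \<in> carrier (section_algebra scale \<tau>)"
    then show "\<exists>\<eta>\<in>carrier (section_algebra scale \<tau>).
        \<eta> \<oplus>\<^bsub>section_algebra scale \<tau>\<^esub> \<xi> = \<zero>\<^bsub>section_algebra scale \<tau>\<^esub>"
      by (intro bexI[of _ "\<lambda>a. (a, - snd (\<xi> a))"]) (simp_all add: sel closed)
  \<comment> \<open>Membership goals follow from \<open>closed\<close>; the remaining equations
    between sections are checked at each base point.\<close>
  qed (simp_all add: closed section_algebra_sel(1), auto simp: sel tau_add tau_scale
      scale_right_distrib scale_left_distrib ring_of_type_algebra_def add_ac
      intro!: ext prod_eqI)
qed

theorem proposition2p1: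
  fixes scale :: "complex \<Rightarrow> 'a::topological_ab_group_add \<Rightarrow> 'a"
    and \<tau> :: "'a \<Rightarrow> 'a \<Rightarrow> 'a \<Rightarrow> 'a"
  assumes "complex_topological_vector_space scale"
    and "ternary_algebra scale \<tau>"
    and "continuous_on UNIV (\<lambda>(a, b, c). \<tau> a b c)"
  shows "(lr_partially_associative \<tau> \<longleftrightarrow> associative_vector_bundle \<tau>) \<and>
    (lr_partially_associative \<tau> \<longrightarrow>
      (\<forall>a. associative_binary_algebra (fiber_algebra scale \<tau> a)) \<and>
      associative_binary_algebra (section_algebra scale \<tau>))"
proof (intro conjI impI allI)
  show "lr_partially_associative \<tau> \<longleftrightarrow> associative_vector_bundle \<tau>"
    by (simp add: associative_vector_bundle_iff)
next
  interpret ternary_algebra scale \<tau> by fact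
  assume assoc: "lr_partially_associative \<tau>"
  \<comment> \<open>Both middle arguments in the ternary identity are taken to be the base point
    \<open>a\<close>; for sections below, the same instance is used at every point.\<close>
  show "associative_binary_algebra (fiber_algebra scale \<tau> a)" for a
    using binary_algebra_fiber assoc
    by (auto simp: associative_binary_algebra_def associative_binary_algebra_axioms_def
        fiber_algebra_sel mem_fiber_iff lr_partially_associative_def)
  show "associative_binary_algebra (section_algebra scale \<tau>)"
    using binary_algebra_sections[OF assms] assoc
    by (auto simp: associative_binary_algebra_def associative_binary_algebra_axioms_def
        section_algebra_sel fiber_algebra_sel fst_section lr_partially_associative_def)
qed

end
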